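(* There exists a Tychonoff, extremally disconnected (thus almost-normal), pseudocompact topological space which is not countably compact.
   Context: A regular closed set of a topological space $X$ is a closed set $F$ with $F=\operatorname{cl}(\operatorname{int}(F))$. A topological space $X$ is almost-normal iff whenever $F$ is a closed set and $K$ is a regular closed set disjoint from $F$, there exist disjoint open sets $U,V$ such that $F\subseteq U$ and $K\subseteq V$. A space is extremally disconnected if the closure of every open set is open. A space is pseudocompact if every continuous real-valued function on it is bounded. A space is countably compact if every countable open cover has a finite subcover. *)

theory Defs
  imports "HOL-Analysis.Analysis"
begin

definition Tychonoff_space :: "'a topology \<Rightarrow> bool" where
  "Tychonoff_space X \<longleftrightarrow> completely_regular_space X \<and> Hausdorff_space X"

definition regular_closedin :: "'a topology \<Rightarrow> 'a set \<Rightarrow> bool" where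
  "regular_closedin X F \<longleftrightarrow> closedin X F \<and> F = X closure_of (X interior_of F)"

definition almost_normal_space :: "'a topology \<Rightarrow> bool" where
  "almost_normal_space X \<longleftrightarrow>
     (\<forall>F K. closedin X F \<and> regular_closedin X K \<and> disjnt F K \<longrightarrow>
        (\<exists>U V. openin X U \<and> openin X V \<and> F \<subseteq> U \<and> K \<subseteq> V \<and> disjnt U V))"

definition extremally_disconnected_space :: "'a topology \<Rightarrow> bool" where
  "extremally_disconnected_space X \<longleftrightarrow>
     (\<forall>U. openin X U \<longrightarrow> openin X (X closure_of U))"

definition pseudocompact_space :: "'a topology \<Rightarrow> bool" where
  "pseudocompact_space X \<longleftrightarrow>
     (\<forall>f::'a \<Rightarrow> real. continuous_map X euclideanreal f \<longrightarrow> bounded (f ` topspace X))"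

text \<open>The library constant \<open>countably_compact\<close> is tied to type-class topologies;
  this is its analogue for abstract topologies.\<close>

definition countably_compact_space :: "'a topology \<Rightarrow> bool" where
  "countably_compact_space X \<longleftrightarrow>
     (\<forall>\<U>. countable \<U> \<and> (\<forall>U \<in> \<U>. openin X U) \<and> topspace X \<subseteq> \<Union>\<U> \<longrightarrow>
        (\<exists>\<F>. finite \<F> \<and> \<F> \<subseteq> \<U> \<and> topspace X \<subseteq> \<Union>\<F>))"

end

(* The Stone-Cech compactification of the natural numbers is the space of ultrafilters
   on nat, in which the principal ultrafilters form a dense set of isolated points. Every subspace X
   containing the principal ultrafilters is zero-dimensional, Hausdorff and extremally disconnected:
   the closure of an open U is the basic clopen set of those ultrafilters that contain
   {k. principal k : U}. If moreover every infinite A belongs to some free ultrafilter in X, then X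
   is pseudocompact: an unbounded continuous function tends to infinity along some infinite set A of
   principal ultrafilters, so it cannot be continuous at a free ultrafilter containing A.

   Partition nat into infinite columns and let p n be a free ultrafilter containing column n. Delete
   from the compactification the accumulation points of D = {p n | n}. Then D is closed, discrete and
   infinite in the remaining X, so X is not countably compact. Every infinite A still belongs to a
   free ultrafilter in X: some infinite B <= A is in no p n, namely B = A if A meets each column in a
   finite set, and otherwise one of two infinite halves of the intersection of A with a column. *)
theory Submission
  imports Defs
begin

section \<open>Ultrafilters\<close>

text \<open>The complement clause encodes maximality and properness at once: together with upward
  closure it forces \<open>UNIV\<close> in and \<open>{}\<close> out.\<close>

definition ultrafilter :: "'a set set \<Rightarrow> bool" where
  "ultrafilter p \<longleftrightarrow>
     (\<forall>A\<in>p. \<forall>B\<in>p. A \<inter> B \<in> p) \<and> (\<forall>A\<in>p. \<forall>B. A \<subseteq> B \<longrightarrow> B \<in> p) \<and> (\<forall>A. - A \<in> p \<longleftrightarrow> A \<notin> p)"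

definition principal_ultrafilter :: "'a \<Rightarrow> 'a set set" where
  "principal_ultrafilter k = {A. k \<in> A}"

lemma mem_principal_ultrafilter [simp]: "A \<in> principal_ultrafilter k \<longleftrightarrow> k \<in> A"
  by (simp add: principal_ultrafilter_def)

lemma ultrafilter_principal: "ultrafilter (principal_ultrafilter k)"
  by (auto simp: ultrafilter_def)

lemma ultrafilter_Int: "\<lbrakk>ultrafilter p; A \<in> p; B \<in> p\<rbrakk> \<Longrightarrow> A \<inter> B \<in> p"
  by (auto simp: ultrafilter_def)

lemma ultrafilter_mono: "\<lbrakk>ultrafilter p; A \<in> p; A \<subseteq> B\<rbrakk> \<Longrightarrow> B \<in> p"
  unfolding ultrafilter_def by blast

lemma ultrafilter_Compl_iff: "ultrafilter p \<Longrightarrow> - A \<in> p \<longleftrightarrow> A \<notin> p"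
  by (auto simp: ultrafilter_def)

lemma empty_notin_ultrafilter: "ultrafilter p \<Longrightarrow> {} \<notin> p"
  by (metis ultrafilter_Compl_iff ultrafilter_mono empty_subsetI)

lemma UNIV_in_ultrafilter: "ultrafilter p \<Longrightarrow> UNIV \<in> p"
  by (metis ultrafilter_Compl_iff empty_notin_ultrafilter Compl_empty_eq)

lemma ultrafilter_disjoint: "\<lbrakk>ultrafilter p; A \<in> p; A \<inter> B = {}\<rbrakk> \<Longrightarrow> B \<notin> p"
  by (metis ultrafilter_Int empty_notin_ultrafilter)

lemma ultrafilter_separation:
  assumes "ultrafilter p" "ultrafilter q" "p \<noteq> q"
  obtains A where "A \<in> p" "- A \<in> q"
  using assms by (metis ultrafilter_Compl_iff set_eqI double_complement)

text \<open>Zorn's lemma is applied to families containing A all of whose finite intersections are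
  infinite, not just nonempty, so that a maximal one has only infinite members.\<close>

lemma free_ultrafilter_exists:
  assumes "infinite (A :: 'a set)"
  obtains p where "ultrafilter p" "A \<in> p" "\<And>B. B \<in> p \<Longrightarrow> infinite B"
proof -
  define \<F> :: "'a set set set" where
    "\<F> = {F. A \<in> F \<and> (\<forall>S. finite S \<and> S \<subseteq> F \<longrightarrow> infinite (\<Inter>S))}"
  have "{A} \<in> \<F>"
  proof -
    have "infinite (\<Inter>S)" if "S \<subseteq> {A}" for S
    proof (cases "S = {}")
      case True
      then show ?thesis
        using assms infinite_super[of A UNIV] by simp
    next
      case False
      then show ?thesis
        using that assms by (auto simp: subset_singleton_iff)
    qed
    then show ?thesis by (simp add: \<F>_def)
  qed
  moreover have "\<Union>\<C> \<in> \<F>" if \<C>: "\<C> \<noteq> {}" "subset.chain \<F> \<C>" for \<C>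
  proof -
    have sub: "\<C> \<subseteq> \<F>"
      using \<C> by (simp add: subset_chain_def)
    have "infinite (\<Inter>S)" if "finite S" "S \<subseteq> \<Union>\<C>" for S
    proof -
      obtain F where "F \<in> \<C>" "S \<subseteq> F"
        using finite_subset_Union_chain \<C> \<open>finite S\<close> \<open>S \<subseteq> \<Union>\<C>\<close> by metis
      then show ?thesis
        using sub that by (auto simp: \<F>_def)
    qed
    moreover have "A \<in> \<Union>\<C>"
      using \<C>(1) sub by (auto simp: \<F>_def)
    ultimately show ?thesis by (simp add: \<F>_def)
  qed
  ultimately obtain p where "p \<in> \<F>" and maximal: "\<And>F. \<lbrakk>F \<in> \<F>; p \<subseteq> F\<rbrakk> \<Longrightarrow> F = p"
    using subset_Zorn_nonempty[of \<F>] by blast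
  then have "A \<in> p" and fip: "\<And>S. \<lbrakk>finite S; S \<subseteq> p\<rbrakk> \<Longrightarrow> infinite (\<Inter>S)"
    by (auto simp: \<F>_def)
  \<comment> \<open>By maximality, adding B must produce a finite intersection that is finite;
    dropping B from it leaves members of p whose intersection meets B in a finite set.\<close>
  have notin: "\<exists>S. finite S \<and> S \<subseteq> p \<and> finite (\<Inter>S \<inter> B)" if "B \<notin> p" for B
  proof -
    have "insert B p \<notin> \<F>"
      using maximal that by blast
    then obtain S where S: "finite S" "S \<subseteq> insert B p" "finite (\<Inter>S)"
      using \<open>A \<in> p\<close> by (auto simp: \<F>_def)
    then have "\<Inter>(S - {B}) \<inter> B \<subseteq> \<Inter>S" by blast
    then show ?thesis
      using S by (intro exI[of _ "S - {B}"]) (auto intro: finite_subset)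
  qed
  \<comment> \<open>This covers closure under intersection and under supersets together.\<close>
  have inI: "B \<in> p" if S: "finite S" "S \<subseteq> p" "\<Inter>S \<subseteq> B" for S B
  proof (rule ccontr)
    assume "B \<notin> p"
    then obtain T where T: "finite T" "T \<subseteq> p" "finite (\<Inter>T \<inter> B)"
      using notin by blast
    have "finite (\<Inter>(S \<union> T))"
      using S(3) by (intro finite_subset[OF _ T(3)]) blast
    then show False
      using fip[of "S \<union> T"] S T by auto
  qed
  have inf: "infinite B" if "B \<in> p" for B
    using fip[of "{B}"] that by simp
  have "- B \<in> p \<longleftrightarrow> B \<notin> p" for B
  proof
    assume "- B \<in> p"
    then show "B \<notin> p"
      using fip[of "{B, - B}"] by auto
  next
    assume "B \<notin> p"
    then obtain S where S: "finite S" "S \<subseteq> p" "finite (\<Inter>S \<inter> B)"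
      using notin by blast
    \<comment> \<open>Were both B and its complement missing, their witnesses S and T would have a
      joint intersection finite inside B and finite outside it.\<close>
    show "- B \<in> p"
    proof (rule ccontr)
      assume "- B \<notin> p"
      then obtain T where T: "finite T" "T \<subseteq> p" "finite (\<Inter>T \<inter> - B)"
        using notin by blast
      have "finite (\<Inter>(S \<union> T))"
        by (rule finite_subset[of _ "(\<Inter>S \<inter> B) \<union> (\<Inter>T \<inter> - B)"]) (use S T in auto)
      then show False
        using fip[of "S \<union> T"] S T by auto
    qed
  qed
  moreover have "B \<inter> C \<in> p" if "B \<in> p" "C \<in> p" for B C
    using inI[of "{B, C}"] that by auto
  moreover have "C \<in> p" if "B \<in> p" "B \<subseteq> C" for B C
    using inI[of "{B}"] that by auto
  ultimately have "ultrafilter p"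
    by (auto simp: ultrafilter_def)
  then show ?thesis
    using that \<open>A \<in> p\<close> inf by blast
qed

section \<open>Separation and disconnectedness\<close>

text \<open>The indicator function of the complement of a clopen neighbourhood is continuous and
  does the separating.\<close>

lemma completely_regular_space_clopen_base:
  assumes "\<And>U x. \<lbrakk>openin X U; x \<in> U\<rbrakk> \<Longrightarrow> \<exists>V. openin X V \<and> closedin X V \<and> x \<in> V \<and> V \<subseteq> U"
  shows "completely_regular_space X"
  unfolding completely_regular_space_def
proof (intro allI impI)
  fix S x
  assume asm: "closedin X S \<and> x \<in> topspace X - S"
  then obtain V where V: "openin X V" "closedin X V" "x \<in> V" "V \<subseteq> topspace X - S"
    using assms[of "topspace X - S" x] by blast
  define f where "f y = (if y \<in> V then 0 else 1 :: real)" for y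
  have "openin X {y \<in> topspace X. f y \<in> W}" for W
  proof -
    have "{y \<in> topspace X. f y \<in> W} =
        (if 0 \<in> W then V else {}) \<union> (if 1 \<in> W then topspace X - V else {})"
      using openin_subset[OF V(1)] by (auto simp: f_def)
    then show ?thesis
      using V(1,2) by (auto intro!: openin_Un)
  qed
  then have "continuous_map X (top_of_set {0..1}) f"
    by (auto simp: continuous_map_in_subtopology continuous_map_def f_def)
  moreover have "f x = 0" "f ` S \<subseteq> {1}"
    using V by (auto simp: f_def)
  ultimately show "\<exists>f. continuous_map X (top_of_set {0..1}) f \<and> f x = (0::real) \<and> f ` S \<subseteq> {1}"
    by blast
qed

text \<open>A regular closed K is the closure of an open set, hence clopen here, so K and its
  complement separate.\<close>

lemma extremally_disconnected_imp_almost_normal_space: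
  assumes "extremally_disconnected_space X"
  shows "almost_normal_space X"
  unfolding almost_normal_space_def
proof (intro allI impI)
  fix F K
  assume asm: "closedin X F \<and> regular_closedin X K \<and> disjnt F K"
  then have "openin X K"
    using assms openin_interior_of
    unfolding extremally_disconnected_space_def regular_closedin_def by metis
  moreover have "openin X (topspace X - K)"
    using asm by (auto simp: regular_closedin_def)
  moreover have "F \<subseteq> topspace X - K"
    using asm closedin_subset by (auto simp: disjnt_iff)
  ultimately show "\<exists>U V. openin X U \<and> openin X V \<and> F \<subseteq> U \<and> K \<subseteq> V \<and> disjnt U V"
    by (intro exI[of _ "topspace X - K"] exI[of _ K]) (auto simp: disjnt_iff)
qed

section \<open>Spaces of ultrafilters\<close>

locale ultrafilter_space =
  fixes X :: "'a set set set"
  assumes ultrafilter: "p \<in> X \<Longrightarrow> ultrafilter p"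
    and principal_in: "principal_ultrafilter k \<in> X"
begin

text \<open>This is the subspace topology inherited from the Stone-Cech compactification of the
  discrete set \<open>'a\<close>.\<close>

definition T :: "'a set set topology" where
  "T = topology (\<lambda>U. U \<subseteq> X \<and> (\<forall>p\<in>U. \<exists>A\<in>p. \<forall>q\<in>X. A \<in> q \<longrightarrow> q \<in> U))"

lemma openin_T: "openin T U \<longleftrightarrow> U \<subseteq> X \<and> (\<forall>p\<in>U. \<exists>A\<in>p. \<forall>q\<in>X. A \<in> q \<longrightarrow> q \<in> U)"
proof -
  have "istopology (\<lambda>U. U \<subseteq> X \<and> (\<forall>p\<in>U. \<exists>A\<in>p. \<forall>q\<in>X. A \<in> q \<longrightarrow> q \<in> U))"
    (is "istopology ?L")
    unfolding istopology_def
  proof (intro conjI allI impI)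
    fix U V
    assume U: "?L U" and V: "?L V"
    have "\<exists>A\<in>p. \<forall>q\<in>X. A \<in> q \<longrightarrow> q \<in> U \<inter> V" if "p \<in> U \<inter> V" for p
    proof -
      have "p \<in> U" "p \<in> V"
        using that by auto
      obtain A where A: "A \<in> p" "\<forall>q\<in>X. A \<in> q \<longrightarrow> q \<in> U"
        using bspec[OF conjunct2[OF U] \<open>p \<in> U\<close>] by (elim bexE)
      obtain B where B: "B \<in> p" "\<forall>q\<in>X. B \<in> q \<longrightarrow> q \<in> V"
        using bspec[OF conjunct2[OF V] \<open>p \<in> V\<close>] by (elim bexE)
      have "ultrafilter p"
        using conjunct1[OF U] \<open>p \<in> U\<close> by (intro ultrafilter) (rule subsetD)
      then have "A \<inter> B \<in> p"
        using A(1) B(1) by (rule ultrafilter_Int)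
      moreover have "q \<in> U \<inter> V" if "q \<in> X" "A \<inter> B \<in> q" for q
        using A(2) B(2) ultrafilter_mono[OF ultrafilter that(2)] that(1)
        by (metis IntI Int_lower1 Int_lower2)
      ultimately show ?thesis
        by (intro bexI[of _ "A \<inter> B"] ballI impI)
    qed
    then show "\<forall>p\<in>U \<inter> V. \<exists>A\<in>p. \<forall>q\<in>X. A \<in> q \<longrightarrow> q \<in> U \<inter> V"
      by (rule ballI)
    show "U \<inter> V \<subseteq> X"
      using conjunct1[OF U] by (rule le_infI1)
  next
    fix \<K>
    assume \<K>: "\<forall>K\<in>\<K>. ?L K"
    then show "\<Union>\<K> \<subseteq> X"
      by (simp add: Union_least)
    show "\<forall>p\<in>\<Union>\<K>. \<exists>A\<in>p. \<forall>q\<in>X. A \<in> q \<longrightarrow> q \<in> \<Union>\<K>"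
    proof
      fix p
      assume "p \<in> \<Union>\<K>"
      then obtain K where "K \<in> \<K>" "p \<in> K" by blast
      then obtain A where "A \<in> p" "\<forall>q\<in>X. A \<in> q \<longrightarrow> q \<in> K"
        using bspec[OF conjunct2[OF bspec[OF \<K> \<open>K \<in> \<K>\<close>]] \<open>p \<in> K\<close>] by (elim bexE)
      then show "\<exists>A\<in>p. \<forall>q\<in>X. A \<in> q \<longrightarrow> q \<in> \<Union>\<K>"
        using \<open>K \<in> \<K>\<close> by (intro bexI[of _ A]) auto
    qed
  qed
  then show ?thesis
    unfolding T_def by (simp add: topology_inverse')
qed

lemma topspace_T: "topspace T = X"
proof -
  have "openin T X"
    using UNIV_in_ultrafilter ultrafilter by (auto simp: openin_T)
  then show ?thesis
    using openin_subset openin_T openin_topspace by blast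
qed

definition basic :: "'a set \<Rightarrow> 'a set set set" where
  "basic A = {p \<in> X. A \<in> p}"

lemma openin_basic: "openin T (basic A)"
  by (auto simp: openin_T basic_def)

lemma closedin_basic: "closedin T (basic A)"
proof -
  have "topspace T - basic A = basic (- A)"
    using ultrafilter ultrafilter_Compl_iff by (auto simp: topspace_T basic_def)
  then show ?thesis
    using openin_basic by (auto simp: closedin_def topspace_T basic_def)
qed

lemma open_contains_basic:
  assumes "openin T U" "p \<in> U"
  obtains A where "p \<in> basic A" "basic A \<subseteq> U"
proof -
  have U: "U \<subseteq> X" "\<forall>p\<in>U. \<exists>A\<in>p. \<forall>q\<in>X. A \<in> q \<longrightarrow> q \<in> U"
    using assms(1) by (simp_all add: openin_T)
  obtain A where "A \<in> p" "\<forall>q\<in>X. A \<in> q \<longrightarrow> q \<in> U"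
    using bspec[OF U(2) assms(2)] by (elim bexE)
  then show ?thesis
    using that[of A] U(1) assms(2) by (auto simp: basic_def)
qed

lemma principal_in_basic [simp]: "principal_ultrafilter k \<in> basic A \<longleftrightarrow> k \<in> A"
  using principal_in by (simp add: basic_def)

text \<open>No ultrafilter contains \<open>{}\<close>, so a nonempty \<open>basic A\<close> has an
  index k in A. This is the density of the principal ultrafilters.\<close>

lemma open_contains_principal:
  assumes "openin T U" "U \<noteq> {}"
  obtains k where "principal_ultrafilter k \<in> U"
proof -
  obtain p A where p: "p \<in> basic A" "basic A \<subseteq> U"
    using assms open_contains_basic by (metis ex_in_conv)
  then have "A \<noteq> {}"
    using empty_notin_ultrafilter ultrafilter by (auto simp: basic_def)
  then show ?thesis
    using p that by (metis ex_in_conv principal_in_basic subsetD)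
qed

lemma Tychonoff_T: "Tychonoff_space T"
  unfolding Tychonoff_space_def
proof
  show "completely_regular_space T"
    by (rule completely_regular_space_clopen_base)
       (metis open_contains_basic openin_basic closedin_basic)
  show "Hausdorff_space T"
    unfolding Hausdorff_space_def
  proof (intro allI impI)
    fix p q
    assume pq: "p \<in> topspace T \<and> q \<in> topspace T \<and> p \<noteq> q"
    then obtain A where "A \<in> p" "- A \<in> q"
      using ultrafilter_separation ultrafilter topspace_T by metis
    moreover have "disjnt (basic A) (basic (- A))"
      using ultrafilter ultrafilter_Compl_iff by (auto simp: disjnt_iff basic_def)
    ultimately show "\<exists>U V. openin T U \<and> openin T V \<and> p \<in> U \<and> q \<in> V \<and> disjnt U V"
      using pq openin_basic topspace_T
      by (intro exI[of _ "basic A"] exI[of _ "basic (- A)"]) (auto simp: basic_def)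
  qed
qed

text \<open>U and the basic set have the same principal points, and by density a nonempty open set
  witnessing a failure of either inclusion would contain a principal point.\<close>

lemma closure_of_open:
  assumes "openin T U"
  shows "T closure_of U = basic {k. principal_ultrafilter k \<in> U}"
proof
  let ?A = "{k. principal_ultrafilter k \<in> U}"
  have "U \<subseteq> basic ?A"
  proof (rule ccontr)
    assume "\<not> U \<subseteq> basic ?A"
    then have "U \<inter> (topspace T - basic ?A) \<noteq> {}"
      using openin_subset[OF assms] by blast
    moreover have "openin T (U \<inter> (topspace T - basic ?A))"
      using assms closedin_basic by blast
    ultimately obtain k where "principal_ultrafilter k \<in> U \<inter> (topspace T - basic ?A)"
      using open_contains_principal by blast
    then show False by auto
  qed
  then show "T closure_of U \<subseteq> basic ?A"
    using closedin_basic by (rule closure_of_minimal)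
  show "basic ?A \<subseteq> T closure_of U"
  proof
    fix p
    assume p: "p \<in> basic ?A"
    have "\<exists>q\<in>U. q \<in> V" if V: "p \<in> V" "openin T V" for V
    proof -
      have "openin T (V \<inter> basic ?A)" "V \<inter> basic ?A \<noteq> {}"
        using p V openin_basic by auto
      then obtain k where "principal_ultrafilter k \<in> V \<inter> basic ?A"
        using open_contains_principal by blast
      then show ?thesis by auto
    qed
    then show "p \<in> T closure_of U"
      using p by (auto simp: in_closure_of topspace_T basic_def)
  qed
qed

lemma extremally_disconnected_T: "extremally_disconnected_space T"
  by (simp add: extremally_disconnected_space_def closure_of_open openin_basic)

lemma pseudocompact_T:
  assumes free: "\<And>A. infinite A \<Longrightarrow> \<exists>p\<in>X. A \<in> p \<and> (\<forall>B\<in>p. infinite B)"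
  shows "pseudocompact_space T"
  unfolding pseudocompact_space_def
proof (intro allI impI)
  fix f :: "'a set set \<Rightarrow> real"
  assume f: "continuous_map T euclideanreal f"
  show "bounded (f ` topspace T)"
  proof (rule ccontr)
    assume unbounded: "\<not> bounded (f ` topspace T)"
    \<comment> \<open>Density moves the unboundedness of f to the principal points.\<close>
    have "\<exists>k. real n < \<bar>f (principal_ultrafilter k)\<bar>" for n
    proof -
      have "open {y::real. real n < \<bar>y\<bar>}"
        by (intro open_Collect_less continuous_intros)
      then have "openin T {x \<in> topspace T. f x \<in> {y. real n < \<bar>y\<bar>}}"
        using f by (intro openin_continuous_map_preimage[OF f]) simp
      moreover have "{x \<in> topspace T. f x \<in> {y. real n < \<bar>y\<bar>}} \<noteq> {}"
        using unbounded by (force simp: bounded_iff not_le)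
      ultimately show ?thesis
        using open_contains_principal by blast
    qed
    then obtain k where k: "\<And>n. real n < \<bar>f (principal_ultrafilter (k n))\<bar>"
      by metis
    have fin: "finite {i \<in> range k. \<bar>f (principal_ultrafilter i)\<bar> \<le> M}" for M
    proof -
      have "{i \<in> range k. \<bar>f (principal_ultrafilter i)\<bar> \<le> M} \<subseteq> k ` {n. n \<le> nat \<lceil>M\<rceil>}"
      proof
        fix i
        assume "i \<in> {i \<in> range k. \<bar>f (principal_ultrafilter i)\<bar> \<le> M}"
        then obtain n where n: "i = k n" "\<bar>f (principal_ultrafilter (k n))\<bar> \<le> M"
          by blast
        then have "real n < M"
          using k[of n] by linarith
        then have "n \<le> nat \<lceil>M\<rceil>" by linarith
        then show "i \<in> k ` {n. n \<le> nat \<lceil>M\<rceil>}"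
          using n by blast
      qed
      then show ?thesis
        by (rule finite_subset) simp
    qed
    have "infinite (range k)"
    proof
      assume "finite (range k)"
      then obtain M where "\<And>i. i \<in> range k \<Longrightarrow> \<bar>f (principal_ultrafilter i)\<bar> \<le> M"
        using bounded_iff[of "(\<lambda>i. f (principal_ultrafilter i)) ` range k"] finite_imp_bounded
        by (metis finite_imageI imageI real_norm_def)
      moreover obtain n where "M < real n"
        using reals_Archimedean2 by blast
      ultimately show False
        using k[of n] by (meson not_less order.strict_trans rangeI)
    qed
    then obtain p where p: "p \<in> X" "range k \<in> p" "\<forall>B\<in>p. infinite B"
      using free by blast
    \<comment> \<open>The margin 1 makes \<open>\<bar>y\<bar> < M\<close> an open condition
      satisfied at \<open>f p\<close>. It holds on some \<open>basic B\<close> around p, and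
      \<open>range k \<inter> B\<close>, being in p, is infinite, against
      \<open>fin\<close>.\<close>
    define M where "M = \<bar>f p\<bar> + 1"
    have "open {y::real. \<bar>y\<bar> < M}"
      by (intro open_Collect_less continuous_intros)
    then have "openin T {x \<in> topspace T. f x \<in> {y. \<bar>y\<bar> < M}}"
      by (intro openin_continuous_map_preimage[OF f]) simp
    moreover have "p \<in> {x \<in> topspace T. f x \<in> {y. \<bar>y\<bar> < M}}"
      using p by (simp add: topspace_T M_def)
    ultimately obtain B where B: "p \<in> basic B"
        "basic B \<subseteq> {x \<in> topspace T. f x \<in> {y. \<bar>y\<bar> < M}}"
      by (rule open_contains_basic)
    have "range k \<inter> B \<in> p"
      using p B ultrafilter by (intro ultrafilter_Int) (auto simp: basic_def)
    moreover have "range k \<inter> B \<subseteq> {i \<in> range k. \<bar>f (principal_ultrafilter i)\<bar> \<le> M}"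
    proof
      fix i
      assume i: "i \<in> range k \<inter> B"
      then have "principal_ultrafilter i \<in> basic B" by simp
      then have "\<bar>f (principal_ultrafilter i)\<bar> < M"
        using B(2) by blast
      then show "i \<in> {i \<in> range k. \<bar>f (principal_ultrafilter i)\<bar> \<le> M}"
        using i by simp
    qed
    ultimately show False
      using p fin finite_subset by blast
  qed
qed

end

section \<open>Deleting the accumulation points of a discrete sequence\<close>

text \<open>The halves are the even and the odd terms of an injective sequence in A. An ultrafilter
  contains at most one of them.\<close>

lemma infinite_split:
  assumes "infinite A"
  obtains B C where "B \<subseteq> A" "C \<subseteq> A" "infinite B" "infinite C" "B \<inter> C = {}"
proof -
  obtain f :: "nat \<Rightarrow> 'a" where f: "inj f" "range f \<subseteq> A"
    using assms infinite_countable_subset by blast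
  have "infinite (f ` {n. even n})" "infinite (f ` {n. odd n})"
    using f(1) finite_imageD[OF _ inj_on_subset[OF f(1) subset_UNIV]]
      infinite_nat_iff_unbounded[of "Collect even"] infinite_nat_iff_unbounded[of "Collect odd"]
    by (metis mem_Collect_eq even_Suc less_Suc_eq)+
  moreover have "f ` {n. even n} \<inter> f ` {n. odd n} = {}"
    using f(1) by (auto dest: injD)
  ultimately show ?thesis
    using that f(2) by (metis image_mono subset_UNIV subset_trans)
qed

locale discrete_ultrafilter_sequence =
  fixes p :: "nat \<Rightarrow> 'a set set" and column :: "nat \<Rightarrow> 'a set"
  assumes ultrafilter_p: "ultrafilter (p n)"
    and free_p: "A \<in> p n \<Longrightarrow> infinite A"
    and column_in: "column n \<in> p n"
    and disjoint_columns: "m \<noteq> n \<Longrightarrow> column m \<inter> column n = {}"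
begin

text \<open>A set B in q but in no \<open>p n\<close> is a neighbourhood of q missing
  \<open>range p\<close>. Hence exactly the points of the closure of \<open>range p\<close> outside
  \<open>range p\<close> are deleted.\<close>

definition X :: "'a set set set" where
  "X = {q. ultrafilter q \<and> (q \<in> range p \<or> (\<exists>B\<in>q. \<forall>n. B \<notin> p n))}"

text \<open>Disjoint sets cannot share an ultrafilter. Thus \<open>basic (column m)\<close> isolates
  \<open>p m\<close> within \<open>range p\<close>.\<close>

lemma column_in_iff: "column m \<in> p n \<longleftrightarrow> m = n"
  using ultrafilter_disjoint[OF ultrafilter_p column_in] column_in disjoint_columns by metis

lemma infinite_subset_avoiding:
  assumes "infinite A"
  obtains B where "B \<subseteq> A" "infinite B" "\<And>n. B \<notin> p n"
proof (cases "\<exists>n. infinite (A \<inter> column n)")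
  case False
  have "A \<notin> p n" for n
    using False free_p column_in ultrafilter_Int ultrafilter_p by metis
  then show ?thesis
    using assms that by blast
next
  case True
  then obtain n where "infinite (A \<inter> column n)" by blast
  then obtain B C where BC: "B \<subseteq> A \<inter> column n" "C \<subseteq> A \<inter> column n"
      "infinite B" "infinite C" "B \<inter> C = {}"
    using infinite_split by blast
  \<comment> \<open>D is whichever of B and C is not in \<open>p n\<close>; lying inside column n,
    it is in no other \<open>p m\<close> either.\<close>
  then obtain D where D: "D \<subseteq> A \<inter> column n" "infinite D" "D \<notin> p n"
    using ultrafilter_disjoint[OF ultrafilter_p] by metis
  have "D \<notin> p m" if "m \<noteq> n" for m
    using D ultrafilter_mono[OF ultrafilter_p] column_in_iff that by (metis Int_subset_iff)
  then show ?thesis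
    using D that by (metis Int_subset_iff)
qed

sublocale ultrafilter_space X
proof
  show "principal_ultrafilter k \<in> X" for k
  proof -
    have "{k} \<notin> p n" for n
      using free_p by blast
    then show ?thesis
      using ultrafilter_principal by (force simp: X_def)
  qed
qed (simp add: X_def)

text \<open>The subset B of A that avoids every \<open>p n\<close> also certifies that a free
  ultrafilter through B was not deleted.\<close>

lemma free_ultrafilter_in_X:
  assumes "infinite A"
  shows "\<exists>q\<in>X. A \<in> q \<and> (\<forall>B\<in>q. infinite B)"
proof -
  obtain B where B: "B \<subseteq> A" "infinite B" "\<And>n. B \<notin> p n"
    using infinite_subset_avoiding[OF assms] by blast
  obtain q where q: "ultrafilter q" "B \<in> q" "\<And>C. C \<in> q \<Longrightarrow> infinite C"
    using free_ultrafilter_exists[OF B(2)] by blast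
  then have "q \<in> X"
    using B(3) unfolding X_def by blast
  then show ?thesis
    using q ultrafilter_mono[OF q(1,2) B(1)] by blast
qed

lemma p_in_X: "p n \<in> X"
  using ultrafilter_p by (auto simp: X_def)

lemma not_countably_compact_T: "\<not> countably_compact_space T"
proof
  assume compact: "countably_compact_space T"
  \<comment> \<open>Each \<open>p n\<close> lies in exactly one member of this cover, namely
    \<open>basic (column n)\<close>, so a subcover must keep all of these.\<close>
  let ?U = "insert (X - range p) (range (\<lambda>n. basic (column n)))"
  have "openin T (X - range p)"
  proof -
    \<comment> \<open>The set B that admits q to X belongs to no \<open>p n\<close>, so every r
      containing B also lies outside \<open>range p\<close>.\<close>
    have "\<exists>B\<in>q. \<forall>r\<in>X. B \<in> r \<longrightarrow> r \<in> X - range p" if "q \<in> X - range p" for q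
      using that by (auto simp: X_def)
    then show ?thesis
      by (simp add: openin_T)
  qed
  then have "\<forall>U\<in>?U. openin T U"
    using openin_basic by simp
  moreover have "topspace T \<subseteq> \<Union>?U"
    using column_in p_in_X by (auto simp: topspace_T basic_def)
  ultimately obtain \<F> where \<F>: "finite \<F>" "\<F> \<subseteq> ?U" "topspace T \<subseteq> \<Union>\<F>"
    using compact[unfolded countably_compact_space_def, THEN spec, of ?U] by auto
  have "basic (column n) \<in> \<F>" for n
  proof -
    obtain V where "V \<in> \<F>" "p n \<in> V"
      using \<F>(3) p_in_X topspace_T by blast
    then show ?thesis
      using \<F>(2) column_in_iff by (auto simp: basic_def)
  qed
  moreover have "inj (\<lambda>n. basic (column n))"
  proof (rule injI)
    fix m n
    assume "basic (column m) = basic (column n)"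
    moreover have "p m \<in> basic (column m)"
      using p_in_X column_in by (simp add: basic_def)
    ultimately show "m = n"
      using column_in_iff by (simp add: basic_def)
  qed
  ultimately show False
    using \<F>(1) range_inj_infinite by (metis finite_subset image_subsetI)
qed

end

lemma discrete_ultrafilter_sequence_exists:
  obtains p :: "nat \<Rightarrow> nat set set" and column where "discrete_ultrafilter_sequence p column"
proof -
  \<comment> \<open>The pairing bijection cuts the naturals into infinitely many disjoint infinite
    columns.\<close>
  define column where "column n = range (\<lambda>k. prod_encode (n, k))" for n
  have "infinite (column n)" for n
    unfolding column_def by (rule range_inj_infinite) (simp add: inj_def)
  then have "\<exists>p. ultrafilter p \<and> column n \<in> p \<and> (\<forall>B\<in>p. infinite B)" for n
    by (metis free_ultrafilter_exists)
  then obtain p where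
    "\<And>n. ultrafilter (p n) \<and> column n \<in> p n \<and> (\<forall>B\<in>p n. infinite B)"
    by metis
  then have "discrete_ultrafilter_sequence p column"
    by unfold_locales (auto simp: column_def)
  then show ?thesis
    using that by blast
qed

(* HOL cannot quantify existentially over types, so the points of the space are drawn from a
   fixed type of cardinality 2^(2^aleph_0), whose elements can encode ultrafilters on nat. The
   underlying set of the space is topspace X, not the whole type. *)
theorem mainTheorem1:
  shows "\<exists>X :: nat set set topology.
           Tychonoff_space X \<and>
           extremally_disconnected_space X \<and>
           almost_normal_space X \<and>
           pseudocompact_space X \<and>
           \<not> countably_compact_space X"
proof -
  obtain p :: "nat \<Rightarrow> nat set set" and column where "discrete_ultrafilter_sequence p column"
    using discrete_ultrafilter_sequence_exists by blast
  then interpret discrete_ultrafilter_sequence p column .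
  show ?thesis
    using Tychonoff_T extremally_disconnected_T pseudocompact_T[OF free_ultrafilter_in_X]
      extremally_disconnected_imp_almost_normal_space not_countably_compact_T
    by blast
qed

end
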